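(* The diameter of $\Gamma_C^Z(\mathbb{S})$ is at least $3$.
   Context: Cayley-Dickson conventions. Let $\mathcal{M}_0=\mathbb{R}$ with trivial involution, and let $\mathcal{M}_{n+1}=\mathcal{M}_n\times\mathcal{M}_n$ with componentwise real vector space structure, product $(a,b)(c,d)=(ac-\bar d b,\ da+b\bar c)$ and involution $\overline{(a,b)}=(\bar a,-b)$. The sedenions are $\mathbb{S}=\mathcal{M}_4$, with center $\mathbb{R}=\mathbb{R}\cdot 1$. The imaginary part of $x$ is $\mathrm{Im}(x)=\frac{x-\bar x}{2}$. $Z(\mathbb{S})$ denotes the set of zero divisors, i.e. nonzero $u\in\mathbb{S}$ for which there is a nonzero $v\in\mathbb{S}$ with $uv=0$ or $vu=0$. The commutativity graph $\Gamma_C(\mathbb{S})$ is the undirected graph whose vertices are the lines $[x]=\mathbb{R}x$ with $x\in\mathbb{S}\setminus\mathbb{R}$, in which distinct vertices $[x],[y]$ are adjacent iff $xy=yx$. Let $\mathbb{R}+Z(\mathbb{S})$ be the set of elements of $\mathbb{S}$ whose imaginary part is a zero divisor. $\Gamma_C^Z(\mathbb{S})$ is the (induced) subgraph of $\Gamma_C(\mathbb{S})$ on the vertex set $\{[x]\mid x\in\mathbb{R}+Z(\mathbb{S})\}$. *)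

theory Defs
  imports Complex_Main "Graph_Theory.Digraph_Component" "Graph_Theory.Shortest_Path"
begin

section \<open>Cayley-Dickson algebras\<close>

class cayley_dickson = real_vector + times + one +
  fixes cd_conj :: "'a \<Rightarrow> 'a"

instantiation real :: cayley_dickson
begin

definition cd_conj_real :: "real \<Rightarrow> real" where
  "cd_conj_real x = x"

instance ..

end

text \<open>If \<open>'a\<close> is the algebra \<open>M\<^sub>n\<close>, then \<open>'a cd\<close> is its double \<open>M\<^sub>n\<^sub>+\<^sub>1\<close>.
  A separate type is used because the library's product type has two independent
  type parameters and so cannot carry this multiplication.\<close>

datatype 'a cd = CD (cd_fst: 'a) (cd_snd: 'a)

instantiation cd :: (real_vector) real_vector
begin

definition zero_cd :: "'a cd" where
  "0 = CD 0 0"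

definition plus_cd :: "'a cd \<Rightarrow> 'a cd \<Rightarrow> 'a cd" where
  "x + y = CD (cd_fst x + cd_fst y) (cd_snd x + cd_snd y)"

definition uminus_cd :: "'a cd \<Rightarrow> 'a cd" where
  "- x = CD (- cd_fst x) (- cd_snd x)"

definition minus_cd :: "'a cd \<Rightarrow> 'a cd \<Rightarrow> 'a cd" where
  "x - y = CD (cd_fst x - cd_fst y) (cd_snd x - cd_snd y)"

definition scaleR_cd :: "real \<Rightarrow> 'a cd \<Rightarrow> 'a cd" where
  "r *\<^sub>R x = CD (r *\<^sub>R cd_fst x) (r *\<^sub>R cd_snd x)"

instance
  by standard
    (simp_all add: zero_cd_def plus_cd_def uminus_cd_def minus_cd_def scaleR_cd_def
      scaleR_add_left scaleR_add_right)

end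

instantiation cd :: (cayley_dickson) cayley_dickson
begin

definition one_cd :: "'a cd" where
  "1 = CD 1 0"

fun times_cd :: "'a cd \<Rightarrow> 'a cd \<Rightarrow> 'a cd" where
  "CD a b * CD c d = CD (a * c - cd_conj d * b) (d * a + b * cd_conj c)"

fun cd_conj_cd :: "'a cd \<Rightarrow> 'a cd" where
  "cd_conj (CD a b) = CD (cd_conj a) (- b)"

instance ..

end

type_synonym sedenion = "real cd cd cd cd"

definition cd_real :: "'a::cayley_dickson set" where
  "cd_real = range (\<lambda>r. r *\<^sub>R 1)"

definition cd_Im :: "'a::cayley_dickson \<Rightarrow> 'a" where
  "cd_Im x = (1 / 2) *\<^sub>R (x - cd_conj x)"

definition zero_divisors :: "'a::cayley_dickson set" where
  "zero_divisors = {u. u \<noteq> 0 \<and> (\<exists>v. v \<noteq> 0 \<and> (u * v = 0 \<or> v * u = 0))}"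

definition real_plus_zero_divisors :: "'a::cayley_dickson set" where
  "real_plus_zero_divisors = {x. cd_Im x \<in> zero_divisors}"


section \<open>The commutativity graph of the sedenions\<close>

abbreviation line :: "'a::real_vector \<Rightarrow> 'a set" where
  "line x \<equiv> span {x}"

text \<open>Undirected graphs are symmetric digraphs, with pairs of vertices as arcs. Any two
  nonreal elements spanning the same line are nonzero real multiples of each other, so
  whether two lines are adjacent does not depend on the choice of \<open>x\<close> and \<open>y\<close>.\<close>

definition sedenion_comm_graph :: "(sedenion set, sedenion set \<times> sedenion set) pre_digraph" where
  "sedenion_comm_graph =
    \<lparr> verts = {line x |x. x \<notin> cd_real},
      arcs = {(line x, line y) |x y.
        x \<notin> cd_real \<and> y \<notin> cd_real \<and> line x \<noteq> line y \<and> x * y = y * x},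
      tail = fst, head = snd \<rparr>"

definition sedenion_comm_graph_Z :: "(sedenion set, sedenion set \<times> sedenion set) pre_digraph" where
  "sedenion_comm_graph_Z =
    sedenion_comm_graph \<restriction> {line x |x. x \<in> real_plus_zero_divisors}"

lemma wf_sedenion_comm_graph: "wf_digraph sedenion_comm_graph"
  by unfold_locales (auto simp: sedenion_comm_graph_def)

lemma symmetric_sedenion_comm_graph: "symmetric sedenion_comm_graph"
  unfolding symmetric_conv sedenion_comm_graph_def by fastforce

lemma real_plus_zero_divisors_nonreal:
  assumes "(x::sedenion) \<in> real_plus_zero_divisors"
  shows "x \<notin> cd_real"
proof
  assume "x \<in> cd_real"
  then obtain r where "x = r *\<^sub>R 1"
    by (auto simp: cd_real_def)
  then have "cd_conj x = x"
    by (simp add: one_cd_def scaleR_cd_def zero_cd_def uminus_cd_def cd_conj_real_def)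
  then have "cd_Im x = 0"
    by (simp add: cd_Im_def)
  then show False
    using assms by (simp add: real_plus_zero_divisors_def zero_divisors_def)
qed

lemma induced_sedenion_comm_graph_Z: "induced_subgraph sedenion_comm_graph_Z sedenion_comm_graph"
  unfolding sedenion_comm_graph_Z_def
  by (rule wf_digraph.induced_induce[OF wf_sedenion_comm_graph])
    (auto simp: sedenion_comm_graph_def dest: real_plus_zero_divisors_nonreal)

lemma wf_sedenion_comm_graph_Z: "wf_digraph sedenion_comm_graph_Z"
  unfolding sedenion_comm_graph_Z_def
  by (rule wf_digraph.wellformed_induce_subgraph[OF wf_sedenion_comm_graph])

text \<open>The distance of two vertices is the infimum of the lengths of the walks between
  them, that is, of the walk costs under unit weights; it is \<open>\<infinity>\<close> if there is no walk.\<close>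

definition graph_diameter :: "('a, 'b) pre_digraph \<Rightarrow> ereal" where
  "graph_diameter G = (SUP u \<in> verts G. SUP v \<in> verts G. wf_digraph.\<mu> G (\<lambda>_. 1) u v)"

end

theory Submission
  imports Defs
begin

text \<open>
  Let \<open>e\<^sub>0 = 1, e\<^sub>1, \<dots>, e\<^sub>1\<^sub>5\<close> be the standard basis of the sedenions. The lines through
  \<open>e\<^sub>1 + e\<^sub>1\<^sub>0\<close> and \<open>e\<^sub>1 - e\<^sub>1\<^sub>0\<close> have distance at least three.

  Both elements are zero divisors, because
  \<open>(e\<^sub>1 + e\<^sub>1\<^sub>0) (e\<^sub>4 - e\<^sub>1\<^sub>5) = 0\<close> and \<open>(e\<^sub>1 - e\<^sub>1\<^sub>0) (e\<^sub>4 + e\<^sub>1\<^sub>5) = 0\<close>.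
  By bilinearity, an element that commutes with both of them commutes with their sum and
  difference, hence with \<open>e\<^sub>1\<close> and with \<open>e\<^sub>1\<^sub>0\<close>. Two distinct imaginary units \<open>e\<^sub>i\<close> and \<open>e\<^sub>k\<close>
  anticommute, so the centralizer of \<open>e\<^sub>i\<close> is only \<open>\<real> + \<real>e\<^sub>i\<close>, and the centralizers of
  \<open>e\<^sub>1\<close> and \<open>e\<^sub>1\<^sub>0\<close> meet in \<open>\<real>\<close>. Since real elements span no vertex of the graph, the two
  lines have no common neighbour. They are also different and not adjacent: otherwise
  \<open>e\<^sub>1 + e\<^sub>1\<^sub>0\<close> itself would be a nonreal element that commutes with both. The latter
  argument works because adjacency of lines is a statement about all of their elements, which
  again is bilinearity of the multiplication.
\<close>

text \<open>The bilinearity of the product on the double of an algebra needs the linearity of the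
  conjugation on that algebra, so both are carried through the doubling together.\<close>

class bilinear_cayley_dickson = cayley_dickson +
  assumes cd_distrib_right: "(x + y) * z = x * z + y * z"
    and cd_distrib_left: "z * (x + y) = z * x + z * y"
    and cd_scaleR_left: "(r *\<^sub>R x) * y = r *\<^sub>R (x * y)"
    and cd_scaleR_right: "x * (r *\<^sub>R y) = r *\<^sub>R (x * y)"
    and cd_conj_add: "cd_conj (x + y) = cd_conj x + cd_conj y"
    and cd_conj_scaleR: "cd_conj (r *\<^sub>R x) = r *\<^sub>R cd_conj x"

instance real :: bilinear_cayley_dickson
  by standard (simp_all add: cd_conj_real_def algebra_simps)

instance cd :: (bilinear_cayley_dickson) bilinear_cayley_dickson
proof
  fix x y z :: "'a cd" and r :: real
  show "(x + y) * z = x * z + y * z"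
    by (cases x; cases y; cases z) (simp add: plus_cd_def cd_distrib_right cd_distrib_left)
  show "z * (x + y) = z * x + z * y"
    by (cases x; cases y; cases z)
      (simp add: plus_cd_def cd_distrib_right cd_distrib_left cd_conj_add)
  show "(r *\<^sub>R x) * y = r *\<^sub>R (x * y)"
    by (cases x; cases y)
      (simp add: scaleR_cd_def cd_scaleR_left cd_scaleR_right scaleR_add_right scaleR_diff_right)
  show "x * (r *\<^sub>R y) = r *\<^sub>R (x * y)"
    by (cases x; cases y)
      (simp add: scaleR_cd_def cd_scaleR_left cd_scaleR_right cd_conj_scaleR
        scaleR_add_right scaleR_diff_right)
  show "cd_conj (x + y) = cd_conj x + cd_conj y"
    by (cases x; cases y) (simp add: plus_cd_def cd_conj_add)
  show "cd_conj (r *\<^sub>R x) = r *\<^sub>R cd_conj x"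
    by (cases x) (simp add: scaleR_cd_def cd_conj_scaleR)
qed

lemma commute_lines:
  fixes x y :: "'a::bilinear_cayley_dickson"
  assumes "x * y = y * x" and "x' \<in> line x" and "y' \<in> line y"
  shows "x' * y' = y' * x'"
proof -
  obtain r s where "x' = r *\<^sub>R x" "y' = s *\<^sub>R y"
    using assms(2,3) by (auto simp: span_singleton)
  then show ?thesis
    using assms(1) by (simp add: cd_scaleR_left cd_scaleR_right mult.commute)
qed

text \<open>The sum of the two given elements is \<open>2x\<close>, and their difference is \<open>2y\<close>.\<close>

lemma commute_sum_diff:
  fixes x y z :: "'a::bilinear_cayley_dickson"
  assumes plus: "z * (x + y) = (x + y) * z" and minus: "z * (x - y) = (x - y) * z"
  shows "z * x = x * z" and "z * y = y * z"
proof -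
  have "(2::real) *\<^sub>R (z * x) = z * ((x + y) + (x - y))"
    by (simp add: scaleR_2 flip: cd_distrib_left)
  also have "\<dots> = ((x + y) + (x - y)) * z"
    by (simp only: cd_distrib_left[of z "x + y"] cd_distrib_right[of "x + y"] plus minus)
  also have "\<dots> = (2::real) *\<^sub>R (x * z)"
    by (simp add: scaleR_2 flip: cd_distrib_right)
  finally show zx: "z * x = x * z"
    by simp
  show "z * y = y * z"
    using plus zx by (simp add: cd_distrib_left cd_distrib_right)
qed

text \<open>The basis is numbered along the doubling: if \<open>e\<^sub>0, \<dots>, e\<^sub>m\<^sub>-\<^sub>1\<close> is the basis of an algebra,
  then its double has the basis \<open>(e\<^sub>0, 0), \<dots>, (e\<^sub>m\<^sub>-\<^sub>1, 0), (0, e\<^sub>0), \<dots>, (0, e\<^sub>m\<^sub>-\<^sub>1)\<close>.\<close>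

definition e1 :: sedenion where "e1 = CD (CD (CD (CD 0 1) 0) 0) 0"
definition e4 :: sedenion where "e4 = CD (CD 0 1) 0"
definition e10 :: sedenion where "e10 = CD 0 (CD (CD 0 1) 0)"
definition e15 :: sedenion where "e15 = CD 0 (CD 0 (CD 0 (CD 0 1)))"

lemmas sedenion_simps =
  e1_def e4_def e10_def e15_def zero_cd_def one_cd_def plus_cd_def minus_cd_def
  uminus_cd_def scaleR_cd_def cd_conj_real_def

lemma zero_divisor_e1_plus_e10: "e1 + e10 \<in> real_plus_zero_divisors"
proof -
  have "cd_Im (e1 + e10) = e1 + e10"
    by (simp add: cd_Im_def sedenion_simps)
  moreover have "e1 + e10 \<noteq> 0" "e4 - e15 \<noteq> 0" "(e1 + e10) * (e4 - e15) = 0"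
    by (simp_all add: sedenion_simps)
  ultimately show ?thesis
    unfolding real_plus_zero_divisors_def zero_divisors_def mem_Collect_eq by metis
qed

lemma zero_divisor_e1_minus_e10: "e1 - e10 \<in> real_plus_zero_divisors"
proof -
  have "cd_Im (e1 - e10) = e1 - e10"
    by (simp add: cd_Im_def sedenion_simps)
  moreover have "e1 - e10 \<noteq> 0" "e4 + e15 \<noteq> 0" "(e1 - e10) * (e4 + e15) = 0"
    by (simp_all add: sedenion_simps)
  ultimately show ?thesis
    unfolding real_plus_zero_divisors_def zero_divisors_def mem_Collect_eq by metis
qed

lemma cd_cd_cases:
  obtains a b c d where "x = CD (CD a b) (CD c d)"
  by (cases x; cases "cd_fst x"; cases "cd_snd x") auto

text \<open>The unit \<open>e\<^sub>1\<close> anticommutes with every other imaginary unit, so commuting with it kills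
  all imaginary coordinates of \<open>z\<close> but the one of \<open>e\<^sub>1\<close>; that one is killed by \<open>e\<^sub>1\<^sub>0\<close>.\<close>

lemma commute_e1_e10_real:
  assumes "z * e1 = e1 * z" and "z * e10 = e10 * z"
  shows "z \<in> cd_real"
proof -
  obtain p q r s where z: "z = CD (CD p q) (CD r s)"
    by (rule cd_cd_cases)
  obtain p0 p1 p2 p3 where p: "p = CD (CD p0 p1) (CD p2 p3)"
    by (rule cd_cd_cases)
  obtain q0 q1 q2 q3 where q: "q = CD (CD q0 q1) (CD q2 q3)"
    by (rule cd_cd_cases)
  obtain r0 r1 r2 r3 where r: "r = CD (CD r0 r1) (CD r2 r3)"
    by (rule cd_cd_cases)
  obtain s0 s1 s2 s3 where s: "s = CD (CD s0 s1) (CD s2 s3)"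
    by (rule cd_cd_cases)
  have "z = p0 *\<^sub>R 1"
    using assms by (simp add: z p q r s sedenion_simps)
  then show ?thesis
    by (auto simp: cd_real_def)
qed

lemma commute_e1_plus_minus_e10_real:
  assumes "z * (e1 + e10) = (e1 + e10) * z" and "z * (e1 - e10) = (e1 - e10) * z"
  shows "z \<in> cd_real"
  using commute_e1_e10_real commute_sum_diff[OF assms] by blast

lemma arcE:
  assumes "e \<in> arcs sedenion_comm_graph_Z"
  obtains x y where "tail sedenion_comm_graph_Z e = line x" "head sedenion_comm_graph_Z e = line y"
    "y \<notin> cd_real" "x * y = y * x"
proof -
  have "e \<in> arcs sedenion_comm_graph"
    using assms by (simp add: sedenion_comm_graph_Z_def)
  then obtain x y where "e = (line x, line y)" "y \<notin> cd_real" "x * y = y * x"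
    unfolding sedenion_comm_graph_def by auto
  then show thesis
    using that[of x y] by (simp add: sedenion_comm_graph_Z_def sedenion_comm_graph_def)
qed

text \<open>An arc only promises commuting generators of its two ends, and a line has many generators.
  For elements of the two lines, walks can be followed through a middle vertex without keeping
  track of which generator each arc uses.\<close>

lemma arc_commute:
  assumes "e \<in> arcs sedenion_comm_graph_Z"
    and "x \<in> tail sedenion_comm_graph_Z e" and "y \<in> head sedenion_comm_graph_Z e"
  shows "x * y = y * x"
  using assms by (metis arcE commute_lines)

lemma arc_head_nonreal:
  assumes "e \<in> arcs sedenion_comm_graph_Z"
  obtains z where "z \<in> head sedenion_comm_graph_Z e" and "z \<notin> cd_real"
  using assms by (metis arcE singletonI span_base)

lemma walk_length_ge_3:
  assumes "wf_digraph G" and walk: "pre_digraph.awalk G u p v" and "u \<noteq> v"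
    and not_adjacent: "\<And>e. e \<in> arcs G \<Longrightarrow> tail G e = u \<Longrightarrow> head G e \<noteq> v"
    and no_common_neighbour: "\<And>e f. e \<in> arcs G \<Longrightarrow> f \<in> arcs G \<Longrightarrow> tail G e = u \<Longrightarrow>
      head G e = tail G f \<Longrightarrow> head G f \<noteq> v"
  shows "3 \<le> length p"
proof (rule ccontr)
  interpret wf_digraph G by fact
  assume "\<not> 3 \<le> length p"
  then consider "p = []" | e where "p = [e]" | e f where "p = [e, f]"
    by (cases p; cases "tl p"; cases "tl (tl p)") auto
  then show False
    using walk \<open>u \<noteq> v\<close> not_adjacent no_common_neighbour
    by cases (auto simp: awalk_simps)
qed

theorem proposition6p7:
  shows "graph_diameter sedenion_comm_graph_Z \<ge> 3"
proof -
  let ?G = sedenion_comm_graph_Z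
  let ?x = "e1 + e10" and ?y = "e1 - e10"
  interpret wf_digraph ?G by (rule wf_sedenion_comm_graph_Z)
  have x: "?x \<in> line ?x" and y: "?y \<in> line ?y"
    by (auto intro: span_base)
  have x_nonreal: "?x \<notin> cd_real"
    using zero_divisor_e1_plus_e10 by (rule real_plus_zero_divisors_nonreal)
  then have noncommuting: "?x * ?y \<noteq> ?y * ?x"
    using commute_e1_plus_minus_e10_real[of ?x] by auto
  have "3 \<le> ereal (awalk_cost (\<lambda>_. 1) p)" if "awalk (line ?x) p (line ?y)" for p
  proof -
    have "3 \<le> length p"
      using wf_digraph_axioms that
    proof (rule walk_length_ge_3)
      show "line ?x \<noteq> line ?y"
        using commute_lines[of ?y ?y ?x ?y] noncommuting x y by auto
    next
      fix e assume "e \<in> arcs ?G" "tail ?G e = line ?x"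
      then show "head ?G e \<noteq> line ?y"
        using arc_commute[of e ?x ?y] noncommuting x y by auto
    next
      fix e f
      assume e: "e \<in> arcs ?G" and f: "f \<in> arcs ?G"
        and ends: "tail ?G e = line ?x" "head ?G e = tail ?G f"
      obtain z where z: "z \<in> head ?G e" "z \<notin> cd_real"
        using e by (rule arc_head_nonreal)
      have "z * ?x = ?x * z"
        using arc_commute[OF e _ z(1), of ?x] ends x by simp
      then have "z * ?y \<noteq> ?y * z"
        using commute_e1_plus_minus_e10_real z(2) by blast
      then show "head ?G f \<noteq> line ?y"
        using arc_commute[OF f, of z ?y] ends z(1) y by auto
    qed
    then show ?thesis
      by (simp add: awalk_cost_def sum_list_triv)
  qed
  then have "3 \<le> \<mu> (\<lambda>_. 1) (line ?x) (line ?y)"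
    unfolding \<mu>_def by (auto intro: INF_greatest)
  also have "\<dots> \<le> graph_diameter ?G"
    unfolding graph_diameter_def
    using zero_divisor_e1_plus_e10 zero_divisor_e1_minus_e10
    by (intro SUP_upper2[of "line ?x"] SUP_upper2[of "line ?y"])
      (auto simp: sedenion_comm_graph_Z_def)
  finally show ?thesis .
qed

end
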